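(* $V_n$ converges to $V$ uniformly on $\mathbb{R}_+^2$ as $n\to\infty$, and the rate of convergence is exponential: for every $n\in\mathbb{N}$ and $(\phi_0,\phi_1)\in\mathbb{R}_+^2$, $$\frac1c\left(\frac{\mu}{\mu+\lambda}\right)^n\ \ge\ V_n(\phi_0,\phi_1)-V(\phi_0,\phi_1)\ \ge\ 0.$$
   Context: Parameters: $\lambda>0$, $\mu>0$, $c>0$, $m\in(1,2)$. On a probability space with measure $\mathbb{P}_0$, $N=(N_t)_{t\ge0}$ is a Poisson process with rate $\mu$ and jump times $\sigma_1<\sigma_2<\dots$ ($\sigma_0=0$), and $Y_1,Y_2,\dots$ are i.i.d. strictly positive random variables with common distribution $\beta_0$ on $\mathbb{R}^d$, independent of $N$. $X_t=X_0+\sum_{k=1}^{N_t}Y_k$, $\mathbb{F}$ is the natural filtration of $X$, and $\mathcal{S}$ is the set of $\mathbb{F}$-stopping times (the value $+\infty$ is allowed). $\beta_1$ is a probability measure on $\mathbb{R}^d$ with $\beta_0,\beta_1$ mutually absolutely continuous and $r=d\beta_1/d\beta_0$. Define $x(t,x_0)=-\frac{\lambda(2-m)}{\lambda-1}+e^{(\lambda-1)t}\left[x_0+\frac{\lambda(2-m)}{\lambda-1}\right]$ if $\lambda\ne1$ and $x(t,x_0)=x_0+(2-m)t$ if $\lambda=1$; $y(t,y_0)=-\frac{\lambda(m-1)}{\lambda-2}+e^{(\lambda-2)t}\left[y_0+\frac{\lambda(m-1)}{\lambda-2}\right]$ if $\lambda\ne2$ and $y(t,y_0)=y_0+2(m-1)t$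 if $\lambda=2$. The piecewise deterministic Markov process $\tilde\Phi=(\tilde\Phi^{(0)},\tilde\Phi^{(1)})$ in $\mathbb{R}_+^2$ (with $\mathbb{R}_+=[0,\infty)$), started at $\tilde\Phi_0=(\phi_0,\phi_1)$, is given by $\tilde\Phi^{(0)}_t=x(t-\sigma_n,\tilde\Phi^{(0)}_{\sigma_n})$, $\tilde\Phi^{(1)}_t=y(t-\sigma_n,\tilde\Phi^{(1)}_{\sigma_n})$ for $\sigma_n\le t<\sigma_{n+1}$, $n\ge0$, and $\tilde\Phi^{(0)}_{\sigma_n}=(1+\frac1\mu)r(Y_n)\tilde\Phi^{(0)}_{\sigma_n-}$, $\tilde\Phi^{(1)}_{\sigma_n}=(1+\frac2\mu)r(Y_n)\tilde\Phi^{(1)}_{\sigma_n-}$ for $n\ge1$. $\mathbb{E}_0^{\phi_0,\phi_1}$ is the $\mathbb{P}_0$-expectation given $\tilde\Phi_0=(\phi_0,\phi_1)$. With $g(\phi_0,\phi_1)=\phi_0+\phi_1-\frac{\lambda}{c}$, define $$V(\phi_0,\phi_1)=\inf_{\tau\in\mathcal{S}}\mathbb{E}_0^{\phi_0,\phi_1}\left[\int_0^{\tau}e^{-\lambda t}g(\tilde\Phi_t)\,dt\right],\qquad V_n(\phi_0,\phi_1)=\inf_{\tau\in\mathcal{S}}\mathbb{E}_0^{\phi_0,\phi_1}\left[\int_0^{\tau\wedge\sigma_n}e^{-\lambda t}g(\tilde\Phi_t)\,dt\right].$$ *)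

theory Defs
  imports "HOL-Probability.Probability"
begin

section \<open>Poisson process and jump times\<close>

text \<open>
  Poisson process with time set \<open>[0, \<infinity>)\<close>.  The last conjunct on paths, together with monotonicity,
  says that every path has jumps of size one and infinitely many of them, so that the jump times
  satisfy \<open>0 < \<sigma>\<^sub>1 < \<sigma>\<^sub>2 < \<dots> \<longrightarrow> \<infinity>\<close> for every outcome.
\<close>

definition poisson_process :: "'w measure \<Rightarrow> real \<Rightarrow> (real \<Rightarrow> 'w \<Rightarrow> nat) \<Rightarrow> bool" where
  "poisson_process M mu N \<longleftrightarrow>
     (\<forall>t\<ge>0. N t \<in> measurable M (count_space UNIV)) \<and>
     (\<forall>\<omega>\<in>space M.
        N 0 \<omega> = 0 \<and>
        mono_on {0..} (\<lambda>t. N t \<omega>) \<and>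
        (\<forall>t\<ge>0. continuous (at_right t) (\<lambda>s. N s \<omega>)) \<and>
        (\<lambda>t. N t \<omega>) ` {0..} = UNIV) \<and>
     (\<forall>s t. 0 \<le> s \<and> s < t \<longrightarrow>
        distr M (count_space UNIV) (\<lambda>\<omega>. N t \<omega> - N s \<omega>)
          = measure_pmf (poisson_pmf (mu * (t - s)))) \<and>
     (\<forall>u :: nat \<Rightarrow> real. \<forall>k. 0 \<le> u 0 \<and> strict_mono u \<longrightarrow>
        prob_space.indep_vars M (\<lambda>_. count_space UNIV)
          (\<lambda>i \<omega>. N (u (Suc i)) \<omega> - N (u i) \<omega>) {..<k})"

definition jump_time :: "(real \<Rightarrow> 'w \<Rightarrow> nat) \<Rightarrow> nat \<Rightarrow> 'w \<Rightarrow> real" where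
  "jump_time N n \<omega> = Inf {t. 0 \<le> t \<and> n \<le> N t \<omega>}"

section \<open>The observed process and its stopping times\<close>

definition compound_process ::
  "('w \<Rightarrow> real^'d) \<Rightarrow> (real \<Rightarrow> 'w \<Rightarrow> nat) \<Rightarrow> (nat \<Rightarrow> 'w \<Rightarrow> real^'d) \<Rightarrow> real \<Rightarrow> 'w \<Rightarrow> real^'d" where
  "compound_process X0 N Y t \<omega> = X0 \<omega> + (\<Sum>k=1..N t \<omega>. Y k \<omega>)"

text \<open>
  The index set of the filtration is \<open>[0, \<infinity>]\<close> (type \<open>ennreal\<close>), with the sigma-algebra generated by
  the whole process at \<open>\<infinity>\<close>.  The library predicate \<^const>\<open>stopping_time\<close> then applies to times with
  values in \<open>[0, \<infinity>]\<close>; its condition at index \<open>\<infinity>\<close> is void.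
\<close>

definition natural_filtration ::
  "'w measure \<Rightarrow> (real \<Rightarrow> 'w \<Rightarrow> 'e::topological_space) \<Rightarrow> ennreal \<Rightarrow> 'w measure" where
  "natural_filtration M X t =
     sigma (space M) {X s -` B \<inter> space M | s B. 0 \<le> s \<and> ennreal s \<le> t \<and> B \<in> sets borel}"

definition stopping_times ::
  "'w measure \<Rightarrow> ('w \<Rightarrow> real^'d) \<Rightarrow> (real \<Rightarrow> 'w \<Rightarrow> nat) \<Rightarrow> (nat \<Rightarrow> 'w \<Rightarrow> real^'d) \<Rightarrow>
     ('w \<Rightarrow> ennreal) set" where
  "stopping_times M X0 N Y =
     {\<tau>. stopping_time (natural_filtration M (compound_process X0 N Y)) \<tau>}"

section \<open>The piecewise deterministic process\<close>

definition x_flow :: "real \<Rightarrow> real \<Rightarrow> real \<Rightarrow> real \<Rightarrow> real" where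
  "x_flow lam m t x0 =
     (if lam \<noteq> 1
      then - (lam * (2 - m) / (lam - 1)) + exp ((lam - 1) * t) * (x0 + lam * (2 - m) / (lam - 1))
      else x0 + (2 - m) * t)"

definition y_flow :: "real \<Rightarrow> real \<Rightarrow> real \<Rightarrow> real \<Rightarrow> real" where
  "y_flow lam m t y0 =
     (if lam \<noteq> 2
      then - (lam * (m - 1) / (lam - 2)) + exp ((lam - 2) * t) * (y0 + lam * (m - 1) / (lam - 2))
      else y0 + 2 * (m - 1) * t)"

text \<open>
  Value at the \<open>n\<close>-th jump time of a process that starts at \<open>p\<close>, follows \<open>flow\<close> between the jump times
  \<open>\<sigma>\<close> and is multiplied by \<open>a * r (y\<^sub>n)\<close> at \<open>\<sigma>\<^sub>n\<close>.  As \<open>flow\<close> is continuous in time, the left limit at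
  \<open>\<sigma>\<^sub>n\<^sub>+\<^sub>1\<close> is \<open>flow (\<sigma>\<^sub>n\<^sub>+\<^sub>1 - \<sigma>\<^sub>n)\<close> applied to the value at \<open>\<sigma>\<^sub>n\<close>.
\<close>

primrec post_jump ::
  "(real \<Rightarrow> real \<Rightarrow> real) \<Rightarrow> real \<Rightarrow> ('e \<Rightarrow> real) \<Rightarrow> (nat \<Rightarrow> real) \<Rightarrow> (nat \<Rightarrow> 'e) \<Rightarrow> real \<Rightarrow> nat \<Rightarrow> real"
where
  "post_jump flow a r \<sigma> y p 0 = p"
| "post_jump flow a r \<sigma> y p (Suc n) =
     a * r (y (Suc n)) * flow (\<sigma> (Suc n) - \<sigma> n) (post_jump flow a r \<sigma> y p n)"

text \<open>For \<open>t \<ge> 0\<close>, \<open>N t \<omega>\<close> is the index \<open>n\<close> with \<open>\<sigma>\<^sub>n \<le> t < \<sigma>\<^sub>n\<^sub>+\<^sub>1\<close>.\<close>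

definition pdmp ::
  "(real \<Rightarrow> real \<Rightarrow> real) \<Rightarrow> real \<Rightarrow> ('e \<Rightarrow> real) \<Rightarrow> (real \<Rightarrow> 'w \<Rightarrow> nat) \<Rightarrow> (nat \<Rightarrow> 'w \<Rightarrow> 'e) \<Rightarrow>
     real \<Rightarrow> real \<Rightarrow> 'w \<Rightarrow> real" where
  "pdmp flow a r N Y p t \<omega> =
     flow (t - jump_time N (N t \<omega>) \<omega>)
       (post_jump flow a r (\<lambda>n. jump_time N n \<omega>) (\<lambda>n. Y n \<omega>) p (N t \<omega>))"

definition Phi ::
  "real \<Rightarrow> real \<Rightarrow> real \<Rightarrow> ('e \<Rightarrow> real) \<Rightarrow> (real \<Rightarrow> 'w \<Rightarrow> nat) \<Rightarrow> (nat \<Rightarrow> 'w \<Rightarrow> 'e) \<Rightarrow>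
     real \<times> real \<Rightarrow> real \<Rightarrow> 'w \<Rightarrow> real \<times> real" where
  "Phi lam mu m r N Y \<phi> t \<omega> =
     (pdmp (x_flow lam m) (1 + 1 / mu) r N Y (fst \<phi>) t \<omega>,
      pdmp (y_flow lam m) (1 + 2 / mu) r N Y (snd \<phi>) t \<omega>)"

section \<open>The optimal stopping problems\<close>

text \<open>
  Integral of an extended real function as the integral of its positive part minus that of its
  negative part.  It is needed because the costs below may have infinite positive part, for
  instance for \<open>\<tau> = \<infinity>\<close>.  Their negative part is at most \<open>1 / c\<close>, so \<open>\<infinity> - \<infinity>\<close> does not occur.
\<close>

definition ereal_integral :: "'a measure \<Rightarrow> ('a \<Rightarrow> ereal) \<Rightarrow> ereal" where
  "ereal_integral M f =
     enn2ereal (\<integral>\<^sup>+ x. e2ennreal (f x) \<partial>M) - enn2ereal (\<integral>\<^sup>+ x. e2ennreal (- f x) \<partial>M)"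

definition g :: "real \<Rightarrow> real \<Rightarrow> real \<times> real \<Rightarrow> real" where
  "g lam c \<phi> = fst \<phi> + snd \<phi> - lam / c"

definition running_cost ::
  "real \<Rightarrow> real \<Rightarrow> real \<Rightarrow> real \<Rightarrow> ('e \<Rightarrow> real) \<Rightarrow> (real \<Rightarrow> 'w \<Rightarrow> nat) \<Rightarrow> (nat \<Rightarrow> 'w \<Rightarrow> 'e) \<Rightarrow>
     real \<times> real \<Rightarrow> ennreal \<Rightarrow> 'w \<Rightarrow> ereal" where
  "running_cost lam mu c m r N Y \<phi> T \<omega> =
     ereal_integral lborel
       (\<lambda>t. ereal (indicat_real {t. 0 \<le> t \<and> ennreal t \<le> T} t
                   * (exp (- lam * t) * g lam c (Phi lam mu m r N Y \<phi> t \<omega>))))"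

definition V ::
  "real \<Rightarrow> real \<Rightarrow> real \<Rightarrow> real \<Rightarrow> (real^'d \<Rightarrow> real) \<Rightarrow> 'w measure \<Rightarrow> ('w \<Rightarrow> real^'d) \<Rightarrow>
     (real \<Rightarrow> 'w \<Rightarrow> nat) \<Rightarrow> (nat \<Rightarrow> 'w \<Rightarrow> real^'d) \<Rightarrow> real \<times> real \<Rightarrow> ereal" where
  "V lam mu c m r M X0 N Y \<phi> =
     (INF \<tau>\<in>stopping_times M X0 N Y.
        ereal_integral M (\<lambda>\<omega>. running_cost lam mu c m r N Y \<phi> (\<tau> \<omega>) \<omega>))"

definition V_n ::
  "real \<Rightarrow> real \<Rightarrow> real \<Rightarrow> real \<Rightarrow> (real^'d \<Rightarrow> real) \<Rightarrow> 'w measure \<Rightarrow> ('w \<Rightarrow> real^'d) \<Rightarrow>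
     (real \<Rightarrow> 'w \<Rightarrow> nat) \<Rightarrow> (nat \<Rightarrow> 'w \<Rightarrow> real^'d) \<Rightarrow> nat \<Rightarrow> real \<times> real \<Rightarrow> ereal" where
  "V_n lam mu c m r M X0 N Y n \<phi> =
     (INF \<tau>\<in>stopping_times M X0 N Y.
        ereal_integral M
          (\<lambda>\<omega>. running_cost lam mu c m r N Y \<phi> (min (\<tau> \<omega>) (ennreal (jump_time N n \<omega>))) \<omega>))"

end

theory Submission
  imports Defs
begin

text \<open>
  Stopping at \<open>\<tau> \<and> \<sigma>\<^sub>n\<close> instead of \<open>\<tau>\<close> discards the cost accumulated on \<open>(\<sigma>\<^sub>n, \<tau>]\<close>.  Both components of
  the piecewise deterministic process stay nonnegative, so the cost rate \<open>e\<^bsup>-\<lambda>t\<^esup> g\<close> is never below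
  \<open>- e\<^bsup>-\<lambda>t\<^esup> \<lambda> / c\<close>, and what is discarded is worth at least \<open>- e\<^bsup>-\<lambda>\<sigma>\<^sub>n\<^esup> / c\<close> on every path
  (\<open>running_cost_min_le\<close>).  Since \<open>\<sigma>\<^sub>n\<close> is a sum of \<open>n\<close> independent exponential times of rate \<open>\<mu>\<close>, its
  Laplace transform at \<open>\<lambda>\<close> is \<open>(\<mu> / (\<mu> + \<lambda>))\<^sup>n\<close> (\<open>nn_integral_exp_jump_time\<close>).  Taking expectations and
  then the infimum over \<open>\<tau>\<close> bounds \<open>V\<^sub>n - V\<close> from above, uniformly in the starting point.

  For \<open>V \<le> V\<^sub>n\<close> it suffices that \<open>\<tau> \<and> \<sigma>\<^sub>n\<close> is itself a competitor in the problem that defines \<open>V\<close>, that is,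
  that the jump times of \<open>N\<close> are stopping times of the filtration of \<open>X\<close>
  (\<open>jump_time_stopping_time\<close>).  This is where the positivity of the jumps of \<open>X\<close> enters: no jump
  of \<open>N\<close> is invisible in \<open>X\<close>, and no two of them can cancel.

  Costs may be \<open>+\<infinity>\<close>, so the comparison of expectations is carried out for integrals defined as
  positive part minus negative part (\<open>ereal_integral_le_add\<close>).  Such integrals are additive only for
  measurable functions, hence the joint measurability of the process in time and outcome.
\<close>

section \<open>Extended integrals\<close>

text \<open>
  The inequality \<open>a \<le> b + h\<close> rewritten without subtraction, \<open>a\<^sup>+ + b\<^sup>- \<le> b\<^sup>+ + a\<^sup>- + h\<close>, which can be
  integrated term by term even if some of the integrals are infinite.
\<close>

lemma e2ennreal_neg_part_add_le:
  assumes "a \<le> b + enn2ereal h"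
  shows "e2ennreal a + e2ennreal (- b) \<le> e2ennreal b + e2ennreal (- a) + h"
proof -
  have e: "enn2ereal (e2ennreal x) = max 0 x" for x
    by (cases "0 \<le> x") (auto simp: enn2ereal_e2ennreal e2ennreal_neg zero_ennreal.rep_eq max_def not_le less_imp_le)
  have h: "0 \<le> enn2ereal h" by simp
  show ?thesis
    unfolding less_eq_ennreal.rep_eq plus_ennreal.rep_eq e
    using assms h by (cases a; cases b; cases "enn2ereal h") (auto simp: max_def)
qed

text \<open>
  Used twice: for the time integral on one path, and then for the expectation.  Finiteness of the
  two negative parts excludes \<open>\<infinity> - \<infinity>\<close> and permits subtracting them again after integration.
\<close>

lemma ereal_integral_le_add:
  assumes [measurable]: "f1 \<in> borel_measurable M" "f2 \<in> borel_measurable M" "h \<in> borel_measurable M"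
    and le: "\<And>x. x \<in> space M \<Longrightarrow> f1 x \<le> f2 x + enn2ereal (h x)"
    and fin: "(\<integral>\<^sup>+x. e2ennreal (- f1 x) \<partial>M) < \<infinity>" "(\<integral>\<^sup>+x. e2ennreal (- f2 x) \<partial>M) < \<infinity>"
  shows "ereal_integral M f1 \<le> ereal_integral M f2 + enn2ereal (\<integral>\<^sup>+x. h x \<partial>M)"
proof -
  define A1 A2 B1 B2 H where
    "A1 = (\<integral>\<^sup>+x. e2ennreal (f1 x) \<partial>M)" and "A2 = (\<integral>\<^sup>+x. e2ennreal (f2 x) \<partial>M)" and
    "B1 = (\<integral>\<^sup>+x. e2ennreal (- f1 x) \<partial>M)" and "B2 = (\<integral>\<^sup>+x. e2ennreal (- f2 x) \<partial>M)" and
    "H = (\<integral>\<^sup>+x. h x \<partial>M)"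
  have "(\<integral>\<^sup>+x. e2ennreal (f1 x) + e2ennreal (- f2 x) \<partial>M)
      \<le> (\<integral>\<^sup>+x. e2ennreal (f2 x) + e2ennreal (- f1 x) + h x \<partial>M)"
    by (intro nn_integral_mono e2ennreal_neg_part_add_le le)
  then have "A1 + B2 \<le> A2 + B1 + H"
    by (simp add: nn_integral_add A1_def A2_def B1_def B2_def H_def)
  then have "enn2ereal A1 + enn2ereal B2 \<le> enn2ereal A2 + enn2ereal B1 + enn2ereal H"
    by (simp add: less_eq_ennreal.rep_eq plus_ennreal.rep_eq)
  moreover have "enn2ereal B1 < \<infinity>" "enn2ereal B2 < \<infinity>"
    using fin unfolding B1_def[symmetric] B2_def[symmetric] less_ennreal.rep_eq by auto
  moreover have "0 \<le> enn2ereal A1" "0 \<le> enn2ereal A2" "0 \<le> enn2ereal B1" "0 \<le> enn2ereal B2"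
    "0 \<le> enn2ereal H" by simp_all
  ultimately have "enn2ereal A1 - enn2ereal B1 \<le> (enn2ereal A2 - enn2ereal B2) + enn2ereal H"
    by (cases "enn2ereal A1"; cases "enn2ereal A2"; cases "enn2ereal B1"; cases "enn2ereal B2";
        cases "enn2ereal H") auto
  then show ?thesis
    by (simp add: ereal_integral_def A1_def A2_def B1_def B2_def H_def)
qed

lemma nn_integral_neg_part_le:
  assumes "\<And>x. x \<in> space M \<Longrightarrow> - enn2ereal (h x) \<le> f x"
  shows "(\<integral>\<^sup>+x. e2ennreal (- f x) \<partial>M) \<le> (\<integral>\<^sup>+x. h x \<partial>M)"
proof (intro nn_integral_mono)
  fix x assume "x \<in> space M"
  then have "- f x \<le> enn2ereal (h x)"
    using assms[of x] by (simp add: ereal_uminus_le_reorder)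
  then show "e2ennreal (- f x) \<le> h x"
    using e2ennreal_mono by fastforce
qed

lemma ereal_integral_ge:
  assumes "\<And>x. x \<in> space M \<Longrightarrow> - enn2ereal (h x) \<le> f x"
  shows "- enn2ereal (\<integral>\<^sup>+x. h x \<partial>M) \<le> ereal_integral M f"
proof -
  have "enn2ereal (\<integral>\<^sup>+x. e2ennreal (- f x) \<partial>M) \<le> enn2ereal (\<integral>\<^sup>+x. h x \<partial>M)"
    using nn_integral_neg_part_le[OF assms] by (simp add: less_eq_ennreal.rep_eq)
  moreover have "0 \<le> enn2ereal (\<integral>\<^sup>+x. e2ennreal (f x) \<partial>M)" by simp
  ultimately show ?thesis
    unfolding ereal_integral_def
    by (metis add.left_neutral ereal_minus(7) ereal_minus_mono minus_ereal_def)
qed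

lemma borel_measurable_ereal_integral:
  assumes "sigma_finite_measure L"
    and [measurable]: "(\<lambda>(\<omega>, t). f \<omega> t) \<in> borel_measurable (M \<Otimes>\<^sub>M L)"
  shows "(\<lambda>\<omega>. ereal_integral L (f \<omega>)) \<in> borel_measurable M"
proof -
  interpret sigma_finite_measure L by fact
  show ?thesis unfolding ereal_integral_def by measurable
qed

lemma ereal_integral_zero_AE:
  assumes "AE x in M. f x = 0"
  shows "ereal_integral M f = 0"
proof -
  have "(\<integral>\<^sup>+x. e2ennreal (f x) \<partial>M) = (\<integral>\<^sup>+x. 0 \<partial>M)" "(\<integral>\<^sup>+x. e2ennreal (- f x) \<partial>M) = (\<integral>\<^sup>+x. 0 \<partial>M)"
    by (rule nn_integral_cong_AE, use assms in eventually_elim, simp add: e2ennreal_neg)+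
  then show ?thesis by (simp add: ereal_integral_def zero_ennreal.rep_eq)
qed

section \<open>Jump times\<close>

text \<open>
  By right-continuity and discreteness of the values, \<open>N\<close> is constant just after \<open>t\<close>; so if it is
  still below \<open>n\<close> at \<open>t\<close>, the infimum defining \<open>\<sigma>\<^sub>n\<close> is strictly larger than \<open>t\<close>.  Everything about
  jump times below is read off from this equivalence.
\<close>

lemma jump_time_le_iff:
  assumes P: "poisson_process M mu N" and w: "\<omega> \<in> space M" and t: "0 \<le> t"
  shows "jump_time N n \<omega> \<le> t \<longleftrightarrow> n \<le> N t \<omega>"
proof
  have mono: "mono_on {0..} (\<lambda>t. N t \<omega>)" and cont: "continuous (at_right t) (\<lambda>s. N s \<omega>)"
    and surj: "(\<lambda>t. N t \<omega>) ` {0..} = UNIV"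
    using P w t unfolding poisson_process_def by auto
  have bdd: "bdd_below {t. 0 \<le> t \<and> n \<le> N t \<omega>}" by (rule bdd_belowI[of _ 0]) auto
  show "jump_time N n \<omega> \<le> t" if "n \<le> N t \<omega>"
    unfolding jump_time_def using that t by (intro cInf_lower bdd) auto
  show "n \<le> N t \<omega>" if le: "jump_time N n \<omega> \<le> t"
  proof (rule ccontr)
    assume lt: "\<not> n \<le> N t \<omega>"
    have "((\<lambda>s. N s \<omega>) \<longlongrightarrow> N t \<omega>) (at_right t)"
      using cont by (simp add: continuous_within)
    then have "eventually (\<lambda>s. N s \<omega> = N t \<omega>) (at_right t)"
      by (simp add: tendsto_discrete)
    then obtain b where b: "b > t" "\<And>s. t < s \<Longrightarrow> s < b \<Longrightarrow> N s \<omega> = N t \<omega>"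
      unfolding eventually_at_right_field by auto
    obtain s0 where "0 \<le> s0" "N s0 \<omega> = n"
      using surj by (metis UNIV_I atLeast_iff imageE)
    moreover have "b \<le> s" if "0 \<le> s" "n \<le> N s \<omega>" for s
    proof (rule ccontr)
      assume "\<not> b \<le> s"
      then have "N s \<omega> \<le> N t \<omega>"
        using b(2)[of s] mono_onD[OF mono, of s t] t that by (cases "s \<le> t") auto
      with lt that show False by simp
    qed
    ultimately have "b \<le> jump_time N n \<omega>"
      unfolding jump_time_def by (intro cInf_greatest) auto
    with b le show False by simp
  qed
qed

lemma jump_time_nonneg:
  assumes "poisson_process M mu N" "\<omega> \<in> space M"
  shows "0 \<le> jump_time N n \<omega>"
proof -
  have "(\<lambda>t. N t \<omega>) ` {0..} = UNIV" using assms unfolding poisson_process_def by auto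
  then obtain s0 where "0 \<le> s0" "N s0 \<omega> = n" by (metis UNIV_I atLeast_iff imageE)
  then show ?thesis unfolding jump_time_def by (intro cInf_greatest) auto
qed

lemma jump_time_mono:
  assumes "poisson_process M mu N" "\<omega> \<in> space M" "k \<le> n"
  shows "jump_time N k \<omega> \<le> jump_time N n \<omega>"
  using jump_time_le_iff[OF assms(1,2) jump_time_nonneg[OF assms(1,2)]] assms(3) order_trans
  by blast

lemma borel_measurable_jump_time:
  assumes P: "poisson_process M mu N"
  shows "jump_time N n \<in> borel_measurable M"
proof (rule borel_measurableI_le)
  fix a
  show "{\<omega> \<in> space M. jump_time N n \<omega> \<le> a} \<in> sets M"
  proof (cases "0 \<le> a")
    case True
    then have [measurable]: "N a \<in> measurable M (count_space UNIV)"
      using P unfolding poisson_process_def by auto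
    have "{\<omega> \<in> space M. jump_time N n \<omega> \<le> a} = {\<omega> \<in> space M. n \<le> N a \<omega>}"
      using jump_time_le_iff[OF P _ True] by auto
    then show ?thesis by simp
  next
    case False
    then have "{\<omega> \<in> space M. jump_time N n \<omega> \<le> a} = {}"
      using jump_time_nonneg[OF P] False by (auto dest: order_trans)
    then show ?thesis by (metis sets.empty_sets)
  qed
qed

text \<open>
  The process is unconstrained at negative times, hence the truncation \<open>max 0 t\<close>.  Joint
  measurability holds because \<open>{n \<le> N\<^sub>t}\<close> is the set \<open>{\<sigma>\<^sub>n \<le> t}\<close>, a comparison of two measurable
  functions on the product.
\<close>

lemma measurable_counting_process_joint:
  assumes P: "poisson_process M mu N"
  shows "(\<lambda>(\<omega>, t). N (max 0 t) \<omega>) \<in> measurable (M \<Otimes>\<^sub>M borel) (count_space UNIV)"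
proof -
  note borel_measurable_jump_time[OF P, measurable]
  have ge: "{x \<in> space (M \<Otimes>\<^sub>M borel). n \<le> N (max 0 (snd x)) (fst x)} \<in> sets (M \<Otimes>\<^sub>M borel)" for n
  proof -
    have "{x \<in> space (M \<Otimes>\<^sub>M borel). n \<le> N (max 0 (snd x)) (fst x)}
        = {x \<in> space (M \<Otimes>\<^sub>M borel). jump_time N n (fst x) \<le> max 0 (snd x)}"
      using jump_time_le_iff[OF P] by (auto simp: space_pair_measure)
    also have "\<dots> \<in> sets (M \<Otimes>\<^sub>M borel)" by measurable
    finally show ?thesis .
  qed
  show ?thesis
  proof (rule measurable_count_space_eq2_countable[THEN iffD2], safe)
    fix n :: nat
    have "(\<lambda>(\<omega>, t). N (max 0 t) \<omega>) -` {n} \<inter> space (M \<Otimes>\<^sub>M borel)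
      = {x \<in> space (M \<Otimes>\<^sub>M borel). n \<le> N (max 0 (snd x)) (fst x)}
        - {x \<in> space (M \<Otimes>\<^sub>M borel). Suc n \<le> N (max 0 (snd x)) (fst x)}"
      by auto
    then show "(\<lambda>(\<omega>, t). N (max 0 t) \<omega>) -` {n} \<inter> space (M \<Otimes>\<^sub>M borel) \<in> sets (M \<Otimes>\<^sub>M borel)"
      using ge[of n] ge[of "Suc n"] by auto
  qed auto
qed

section \<open>The Laplace transform of the jump times\<close>

lemma nn_integral_exp_tail:
  assumes "0 < lam"
  shows "(\<integral>\<^sup>+t. ennreal (lam * exp (- lam * t)) * indicator {s..} t \<partial>lborel) = ennreal (exp (- lam * s))"
proof -
  have "((\<lambda>t. - exp (- lam * t)) \<longlongrightarrow> 0) at_top"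
    using assms by real_asymp
  then have "(\<integral>\<^sup>+t. ennreal (lam * exp (- lam * t)) * indicator {s..} t \<partial>lborel)
      = ennreal (0 - (- exp (- lam * s)))"
    using assms by (intro nn_integral_FTC_atLeast) (auto intro!: derivative_eq_intros)
  then show ?thesis by simp
qed

lemma emeasure_jump_time_le:
  assumes P: "poisson_process M mu N" and mu: "0 < mu" and t: "0 < t"
  shows "emeasure M {\<omega> \<in> space M. jump_time N n \<omega> \<le> t}
    = (\<Sum>k. ennreal ((mu * t) ^ (k + n) / fact (k + n) * exp (- (mu * t))))"
proof -
  have N0: "\<And>\<omega>. \<omega> \<in> space M \<Longrightarrow> N 0 \<omega> = 0" and [measurable]: "N t \<in> measurable M (count_space UNIV)"
    and D: "distr M (count_space UNIV) (\<lambda>\<omega>. N t \<omega> - N 0 \<omega>) = measure_pmf (poisson_pmf (mu * (t - 0)))"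
    using P t unfolding poisson_process_def by auto
  have D': "distr M (count_space UNIV) (N t) = measure_pmf (poisson_pmf (mu * t))"
    using D by (subst (asm) distr_cong[where g = "N t" and N = "count_space UNIV" and M = M]) (auto simp: N0)
  have "{\<omega> \<in> space M. jump_time N n \<omega> \<le> t} = N t -` {n..} \<inter> space M"
    using jump_time_le_iff[OF P] t by auto
  then have "emeasure M {\<omega> \<in> space M. jump_time N n \<omega> \<le> t}
      = emeasure (distr M (count_space UNIV) (N t)) {n..}"
    by (simp add: emeasure_distr)
  also have "\<dots> = (\<integral>\<^sup>+k. ennreal (pmf (poisson_pmf (mu * t)) (k + n)) \<partial>count_space UNIV)"
  proof -
    have "(\<lambda>k. k + n) ` UNIV = {n..}"
      by (auto simp: image_iff le_iff_add add.commute)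
    then show ?thesis
      unfolding D' by (subst nn_integral_pmf') (auto simp: inj_on_def)
  qed
  also have "\<dots> = (\<Sum>k. ennreal ((mu * t) ^ (k + n) / fact (k + n) * exp (- (mu * t))))"
    using mu t by (subst nn_integral_count_space_nat) simp
  finally show ?thesis .
qed

text \<open>
  Writing \<open>e\<^bsup>-\<lambda>\<sigma>\<^esup>\<close> as the integral of \<open>\<lambda> e\<^bsup>-\<lambda>t\<^esup>\<close> over \<open>t \<ge> \<sigma>\<close> and exchanging the integrals
  reduces the expectation to the integral of \<open>\<lambda> e\<^bsup>-\<lambda>t\<^esup> P(\<sigma>\<^sub>n \<le> t)\<close>, where \<open>P(\<sigma>\<^sub>n \<le> t) = P(N\<^sub>t \<ge> n)\<close> is a
  Poisson tail.  The \<open>j\<close>-th term of that tail, multiplied by \<open>\<lambda> e\<^bsup>-\<lambda>t\<^esup>\<close>, is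
  \<open>\<lambda> / (\<mu> + \<lambda>) \<cdot> (\<mu> / (\<mu> + \<lambda>))\<^sup>j\<close> times the Erlang density of rate \<open>\<mu> + \<lambda>\<close>, so a geometric tail
  remains.
\<close>

lemma nn_integral_exp_jump_time:
  assumes "prob_space M" and P: "poisson_process M mu N" and mu: "0 < mu" and lam: "0 < lam"
  shows "(\<integral>\<^sup>+\<omega>. ennreal (exp (- lam * jump_time N n \<omega>)) \<partial>M) = ennreal ((mu / (mu + lam)) ^ n)"
proof -
  interpret prob_space M by fact
  interpret pair_sigma_finite M lborel ..
  note borel_measurable_jump_time[OF P, measurable]
  have "(\<integral>\<^sup>+\<omega>. ennreal (exp (- lam * jump_time N n \<omega>)) \<partial>M)
      = (\<integral>\<^sup>+\<omega>. (\<integral>\<^sup>+t. ennreal (lam * exp (- lam * t)) * indicator {jump_time N n \<omega>..} t \<partial>lborel) \<partial>M)"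
    unfolding nn_integral_exp_tail[OF lam] ..
  also have "\<dots> = (\<integral>\<^sup>+t. (\<integral>\<^sup>+\<omega>. ennreal (lam * exp (- lam * t)) * indicator {jump_time N n \<omega>..} t \<partial>M) \<partial>lborel)"
    by (rule Fubini'[symmetric]) (unfold indicator_def atLeast_iff, measurable)
  also have "\<dots> = (\<integral>\<^sup>+t. ennreal (lam * exp (- lam * t)) * emeasure M {\<omega> \<in> space M. jump_time N n \<omega> \<le> t} \<partial>lborel)"
  proof (intro nn_integral_cong)
    fix t
    have "(\<integral>\<^sup>+\<omega>. ennreal (lam * exp (- lam * t)) * indicator {jump_time N n \<omega>..} t \<partial>M)
      = (\<integral>\<^sup>+\<omega>. ennreal (lam * exp (- lam * t)) * indicator {\<omega> \<in> space M. jump_time N n \<omega> \<le> t} \<omega> \<partial>M)"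
      by (intro nn_integral_cong) (auto simp: indicator_def)
    then show "(\<integral>\<^sup>+\<omega>. ennreal (lam * exp (- lam * t)) * indicator {jump_time N n \<omega>..} t \<partial>M)
      = ennreal (lam * exp (- lam * t)) * emeasure M {\<omega> \<in> space M. jump_time N n \<omega> \<le> t}"
      by (simp add: nn_integral_cmult_indicator)
  qed
  also have "\<dots> = (\<integral>\<^sup>+t. (\<Sum>k. ennreal (lam / (mu + lam) * (mu / (mu + lam)) ^ (k + n))
                        * ennreal (erlang_density (k + n) (mu + lam) t)) \<partial>lborel)"
  proof (rule nn_integral_cong_AE)
    show "AE t in lborel. ennreal (lam * exp (- lam * t)) * emeasure M {\<omega> \<in> space M. jump_time N n \<omega> \<le> t}
      = (\<Sum>k. ennreal (lam / (mu + lam) * (mu / (mu + lam)) ^ (k + n))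
             * ennreal (erlang_density (k + n) (mu + lam) t))"
      using AE_lborel_singleton[of "0::real"]
    proof eventually_elim
      fix t :: real assume "t \<noteq> 0"
      then consider "t < 0" | "0 < t" by linarith
      then show "ennreal (lam * exp (- lam * t)) * emeasure M {\<omega> \<in> space M. jump_time N n \<omega> \<le> t}
      = (\<Sum>k. ennreal (lam / (mu + lam) * (mu / (mu + lam)) ^ (k + n))
             * ennreal (erlang_density (k + n) (mu + lam) t))"
      proof cases
        case 1
        then have "\<not> jump_time N n \<omega> \<le> t" if "\<omega> \<in> space M" for \<omega>
          using jump_time_nonneg[OF P that, of n] by linarith
        then have "{\<omega> \<in> space M. jump_time N n \<omega> \<le> t} = {}" by auto
        moreover have "erlang_density (k + n) (mu + lam) t = 0" for k
          using 1 by (simp add: erlang_density_def)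
        ultimately show ?thesis by (simp only: emeasure_empty) simp
      next
        case 2
        have *: "lam * exp (- lam * t) * ((mu * t) ^ k / fact k * exp (- (mu * t)))
            = lam / (mu + lam) * (mu / (mu + lam)) ^ k * erlang_density k (mu + lam) t" for k
        proof -
          have e: "exp (- (mu + lam) * t) = exp (- lam * t) * exp (- (mu * t))"
            by (simp add: exp_add[symmetric] algebra_simps)
          have nz: "mu + lam \<noteq> 0" using mu lam by simp
          have "erlang_density k (mu + lam) t
              = (mu + lam) * (mu + lam) ^ k * t ^ k * (exp (- lam * t) * exp (- (mu * t))) / fact k"
            using 2 unfolding e[symmetric] by (simp add: erlang_density_def)
          then show ?thesis
            using nz by (simp add: power_mult_distrib power_divide)
        qed
        show ?thesis
          unfolding emeasure_jump_time_le[OF P mu 2] ennreal_suminf_cmult[symmetric]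
        proof (intro suminf_cong)
          fix k
          let ?j = "k + n"
          have "ennreal (lam * exp (- lam * t)) * ennreal ((mu * t) ^ ?j / fact ?j * exp (- (mu * t)))
              = ennreal (lam * exp (- lam * t) * ((mu * t) ^ ?j / fact ?j * exp (- (mu * t))))"
            using lam by (intro ennreal_mult'[symmetric]) simp
          also have "\<dots> = ennreal (lam / (mu + lam) * (mu / (mu + lam)) ^ ?j * erlang_density ?j (mu + lam) t)"
            unfolding * ..
          also have "\<dots> = ennreal (lam / (mu + lam) * (mu / (mu + lam)) ^ ?j) * ennreal (erlang_density ?j (mu + lam) t)"
            using mu lam by (intro ennreal_mult') simp
          finally show "ennreal (lam * exp (- lam * t)) * ennreal ((mu * t) ^ ?j / fact ?j * exp (- (mu * t)))
              = ennreal (lam / (mu + lam) * (mu / (mu + lam)) ^ ?j) * ennreal (erlang_density ?j (mu + lam) t)" .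
        qed
      qed
    qed
  qed
  also have "\<dots> = (\<Sum>k. ennreal (lam / (mu + lam) * (mu / (mu + lam)) ^ (k + n))
                    * (\<integral>\<^sup>+t. ennreal (erlang_density (k + n) (mu + lam) t) \<partial>lborel))"
    by (simp add: nn_integral_suminf nn_integral_cmult)
  also have "\<dots> = (\<Sum>k. ennreal (lam / (mu + lam) * (mu / (mu + lam)) ^ (k + n)))"
    using nn_integral_erlang_ith_moment[where i = 0 and l = "mu + lam"] mu lam by simp
  also have "\<dots> = ennreal ((mu / (mu + lam)) ^ n)"
  proof (rule suminf_ennreal_eq)
    have "(\<lambda>k. (mu / (mu + lam)) ^ k) sums (1 / (1 - mu / (mu + lam)))"
      using mu lam by (intro geometric_sums) simp
    then have "(\<lambda>k. lam / (mu + lam) * (mu / (mu + lam)) ^ n * (mu / (mu + lam)) ^ k) sums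
        (lam / (mu + lam) * (mu / (mu + lam)) ^ n * (1 / (1 - mu / (mu + lam))))"
      by (rule sums_mult)
    moreover have "lam / (mu + lam) * (1 / (1 - mu / (mu + lam))) = 1"
    proof -
      have "1 - mu / (mu + lam) = lam / (mu + lam)"
        using mu lam by (simp add: field_simps)
      then show ?thesis using mu lam by simp
    qed
    ultimately show "(\<lambda>k. lam / (mu + lam) * (mu / (mu + lam)) ^ (k + n)) sums (mu / (mu + lam)) ^ n"
      using lam by (simp add: power_add mult_ac)
  qed (use mu lam in auto)
  finally show ?thesis .
qed

section \<open>Stopping times of the observed process\<close>

lemma space_natural_filtration: "space (natural_filtration M X T) = space M"
  unfolding natural_filtration_def by (rule space_measure_of) auto

lemma measurable_natural_filtration:
  assumes "0 \<le> s" "ennreal s \<le> T"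
  shows "X s \<in> borel_measurable (natural_filtration M X T)"
proof (rule measurableI)
  fix B :: "'b set" assume "B \<in> sets borel"
  then have "X s -` B \<inter> space M \<in> sets (natural_filtration M X T)"
    using assms unfolding natural_filtration_def by (subst sets_measure_of) auto
  then show "X s -` B \<inter> space (natural_filtration M X T) \<in> sets (natural_filtration M X T)"
    by (simp add: space_natural_filtration)
qed simp

lemma sets_natural_filtration_subset:
  assumes "\<And>s. 0 \<le> s \<Longrightarrow> X s \<in> borel_measurable M"
  shows "sets (natural_filtration M X T) \<subseteq> sets M"
  unfolding natural_filtration_def using assms
  by (subst sets_measure_of) (auto intro!: sets.sigma_sets_subset intro: measurable_sets)

text \<open>
  Each coordinate of \<open>X\<close> strictly increases at every jump of \<open>N\<close>; a single coordinate already
  separates two values of \<open>X\<close>.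
\<close>

lemma compound_process_neq_iff:
  fixes Y :: "nat \<Rightarrow> 'w \<Rightarrow> real^'d"
  assumes P: "poisson_process M mu N" and w: "\<omega> \<in> space M" and st: "0 \<le> s" "s \<le> t"
    and Ypos: "\<And>k i. 1 \<le> k \<Longrightarrow> 0 < Y k \<omega> $ i"
  shows "compound_process X0 N Y s \<omega> \<noteq> compound_process X0 N Y t \<omega> \<longleftrightarrow> N s \<omega> < N t \<omega>"
proof -
  have mono: "N s \<omega> \<le> N t \<omega>"
    using P w st unfolding poisson_process_def by (auto intro: mono_onD)
  have "compound_process X0 N Y s \<omega> \<noteq> compound_process X0 N Y t \<omega>" if lt: "N s \<omega> < N t \<omega>"
  proof -
    fix i :: 'd
    have "(\<Sum>k=1..N s \<omega>. Y k \<omega> $ i) < (\<Sum>k=1..N t \<omega>. Y k \<omega> $ i)"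
      using lt Ypos by (intro sum_strict_mono2[where b = "N t \<omega>"]) (auto intro: less_imp_le)
    then have "compound_process X0 N Y s \<omega> $ i \<noteq> compound_process X0 N Y t \<omega> $ i"
      by (simp add: compound_process_def)
    then show ?thesis by auto
  qed
  moreover have "compound_process X0 N Y s \<omega> = compound_process X0 N Y t \<omega>" if "N s \<omega> = N t \<omega>"
    using that by (simp add: compound_process_def)
  ultimately show ?thesis using mono by fastforce
qed

text \<open>
  The interval between \<open>\<sigma>\<^sub>n\<close> and \<open>\<sigma>\<^sub>n\<^sub>+\<^sub>1\<close> is nondegenerate and thus contains a rational time.  It makes
  the event \<open>{N\<^sub>t \<ge> n + 1}\<close> a countable union.
\<close>

lemma exists_rational_before_next_jump:
  assumes P: "poisson_process M mu N" and w: "\<omega> \<in> space M" and t: "0 \<le> t" and n: "Suc n \<le> N t \<omega>"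
  shows "\<exists>q\<in>\<rat>. 0 \<le> q \<and> q < t \<and> n \<le> N q \<omega> \<and> N q \<omega> < N t \<omega>"
proof -
  have "(\<lambda>t. N t \<omega>) ` {0..} = UNIV" using P w unfolding poisson_process_def by auto
  then obtain s where s: "0 \<le> s" "N s \<omega> = n" by (metis UNIV_I atLeast_iff imageE)
  then have "s < jump_time N (Suc n) \<omega>"
    using jump_time_le_iff[OF P w s(1), of "Suc n"] by auto
  then obtain q where q: "q \<in> \<rat>" "s < q" "q < jump_time N (Suc n) \<omega>"
    using Rats_dense_in_real by blast
  have "jump_time N n \<omega> \<le> q"
    using jump_time_le_iff[OF P w s(1), of n] s q by auto
  then have "n \<le> N q \<omega>" "\<not> Suc n \<le> N q \<omega>"
    using jump_time_le_iff[OF P w, of q n] jump_time_le_iff[OF P w, of q "Suc n"] s q by auto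
  moreover have "q < t"
    using jump_time_le_iff[OF P w t, of "Suc n"] n q by auto
  ultimately show ?thesis using s q n by (intro bexI[of _ q]) auto
qed

locale disorder_problem = prob_space M
  for M :: "'w measure" +
  fixes lam mu c m :: real
    and X0 :: "'w \<Rightarrow> real^'d"
    and N :: "real \<Rightarrow> 'w \<Rightarrow> nat"
    and Y :: "nat \<Rightarrow> 'w \<Rightarrow> real^'d"
    and r :: "real^'d \<Rightarrow> real"
  assumes lam: "0 < lam" and mu: "0 < mu" and c: "0 < c" and m: "1 < m" "m < 2"
    and X0_measurable [measurable]: "X0 \<in> borel_measurable M"
    and poisson: "poisson_process M mu N"
    and Y_measurable: "\<And>k. 1 \<le> k \<Longrightarrow> Y k \<in> borel_measurable M"
    and Y_pos: "\<And>k \<omega> i. 1 \<le> k \<Longrightarrow> \<omega> \<in> space M \<Longrightarrow> 0 < Y k \<omega> $ i"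
    and r_measurable [measurable]: "r \<in> borel_measurable borel"
    and r_nonneg: "\<And>y. 0 \<le> r y"
begin

lemmas jump_measurable [measurable] = borel_measurable_jump_time[OF poisson]

lemma compound_process_measurable:
  assumes "0 \<le> t"
  shows "compound_process X0 N Y t \<in> borel_measurable M"
proof -
  have [measurable]: "N t \<in> measurable M (count_space UNIV)"
    using poisson assms unfolding poisson_process_def by auto
  have "(\<lambda>\<omega>. \<Sum>k=1..j. Y k \<omega>) \<in> borel_measurable M" for j
    by (intro borel_measurable_sum) (auto intro: Y_measurable)
  then have "(\<lambda>\<omega>. \<Sum>k=1..N t \<omega>. Y k \<omega>) \<in> borel_measurable M"
    by (rule measurable_compose_countable) measurable
  then show ?thesis
    unfolding compound_process_def[abs_def] by measurable
qed

text \<open>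
  Induction on \<open>n\<close>: at least \<open>n + 1\<close> jumps have occurred by time \<open>t\<close> iff, for some rational \<open>q < t\<close>,
  at least \<open>n\<close> have occurred by \<open>q\<close> and \<open>X\<^sub>q \<noteq> X\<^sub>t\<close>.  The index \<open>T\<close> of the sigma-algebra stays fixed while
  \<open>t\<close> varies, so that the induction hypothesis at \<open>q\<close> speaks of the same sigma-algebra.
\<close>

lemma jump_count_in_natural_filtration:
  assumes "0 \<le> t" "ennreal t \<le> T"
  shows "{\<omega> \<in> space M. n \<le> N t \<omega>} \<in> sets (natural_filtration M (compound_process X0 N Y) T)"
  using assms
proof (induction n arbitrary: t)
  case 0
  show ?case
    using sets.top[of "natural_filtration M (compound_process X0 N Y) T"]
    by (simp add: space_natural_filtration)
next
  case (Suc n)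
  let ?F = "natural_filtration M (compound_process X0 N Y) T"
  let ?X = "compound_process X0 N Y"
  have le: "q < t \<Longrightarrow> ennreal q \<le> T" for q
    using Suc.prems(2) ennreal_leI[of q t] by (auto intro: order_trans)
  have "{\<omega> \<in> space M. Suc n \<le> N t \<omega>}
      = (\<Union>q\<in>\<rat> \<inter> {0..<t}. {\<omega> \<in> space M. n \<le> N q \<omega>} \<inter> {\<omega> \<in> space ?F. ?X q \<omega> \<noteq> ?X t \<omega>})"
    (is "?A = ?B")
  proof
    show "?A \<subseteq> ?B"
    proof
      fix \<omega> assume "\<omega> \<in> ?A"
      then have w: "\<omega> \<in> space M" "Suc n \<le> N t \<omega>" by auto
      from exists_rational_before_next_jump[OF poisson w(1) Suc.prems(1) w(2)]
      obtain q where q: "q \<in> \<rat>" "0 \<le> q" "q < t" "n \<le> N q \<omega>" "N q \<omega> < N t \<omega>" by auto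
      with compound_process_neq_iff[where Y = Y, OF poisson w(1) q(2) less_imp_le[OF q(3)] Y_pos[OF _ w(1)], of X0]
      show "\<omega> \<in> ?B" using w by (auto simp: space_natural_filtration)
    qed
    show "?B \<subseteq> ?A"
    proof
      fix \<omega> assume "\<omega> \<in> ?B"
      then obtain q where q: "0 \<le> q" "q \<le> t" "n \<le> N q \<omega>" and w: "\<omega> \<in> space M" and X: "?X q \<omega> \<noteq> ?X t \<omega>"
        by auto
      with compound_process_neq_iff[where Y = Y, OF poisson w q(1,2) Y_pos[OF _ w], of X0]
      show "\<omega> \<in> ?A" by auto
    qed
  qed
  also have "\<dots> \<in> sets ?F"
  proof (rule sets.countable_UN'')
    show "countable (\<rat> \<inter> {0..<t})" by (simp add: countable_rat)
    fix q assume q: "q \<in> \<rat> \<inter> {0..<t}"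
    have [measurable]: "?X q \<in> borel_measurable ?F" "?X t \<in> borel_measurable ?F"
      using q le Suc.prems by (auto intro!: measurable_natural_filtration)
    have "{\<omega> \<in> space ?F. ?X q \<omega> \<noteq> ?X t \<omega>} \<in> sets ?F" by measurable
    moreover have "{\<omega> \<in> space M. n \<le> N q \<omega>} \<in> sets ?F"
      using q le by (intro Suc.IH) auto
    ultimately show "{\<omega> \<in> space M. n \<le> N q \<omega>} \<inter> {\<omega> \<in> space ?F. ?X q \<omega> \<noteq> ?X t \<omega>} \<in> sets ?F"
      by (rule sets.Int[rotated])
  qed
  finally show ?case .
qed

lemma jump_time_stopping_time:
  "(\<lambda>\<omega>. ennreal (jump_time N n \<omega>)) \<in> stopping_times M X0 N Y"
  unfolding stopping_times_def mem_Collect_eq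
proof
  fix T :: ennreal
  let ?F = "natural_filtration M (compound_process X0 N Y)"
  show "Measurable.pred (?F T) (\<lambda>\<omega>. ennreal (jump_time N n \<omega>) \<le> T)"
  proof (cases T)
    case (real t)
    have "{\<omega> \<in> space (?F T). ennreal (jump_time N n \<omega>) \<le> T} = {\<omega> \<in> space M. n \<le> N t \<omega>}"
      using real jump_time_le_iff[OF poisson _ real(1)] jump_time_nonneg[OF poisson]
      by (auto simp: space_natural_filtration)
    then show ?thesis
      using jump_count_in_natural_filtration[of t T n] real by (simp add: pred_def)
  qed simp
qed

lemma stopping_time_measurable:
  assumes "\<tau> \<in> stopping_times M X0 N Y"
  shows "\<tau> \<in> borel_measurable M"
  using assms unfolding stopping_times_def mem_Collect_eq
  by (rule measurable_stopping_time)
     (auto simp: space_natural_filtration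
       dest!: subsetD[OF sets_natural_filtration_subset, rotated] intro: compound_process_measurable)

lemma min_jump_time_stopping_time:
  assumes "\<tau> \<in> stopping_times M X0 N Y"
  shows "(\<lambda>\<omega>. min (\<tau> \<omega>) (ennreal (jump_time N n \<omega>))) \<in> stopping_times M X0 N Y"
  using assms jump_time_stopping_time[of n] unfolding stopping_times_def
  by (auto intro: stopping_time_min)

end

section \<open>Costs along a path\<close>

text \<open>
  This is the flow of \<open>p' = a p + b\<close>.  Rewritten as \<open>e\<^bsup>at\<^esup> p + b (e\<^bsup>at\<^esup> - 1) / a\<close> it is a sum of two
  nonnegative terms, because \<open>e\<^bsup>at\<^esup> - 1\<close> and \<open>a\<close> have the same sign.
\<close>

lemma exp_affine_nonneg:
  fixes a b p t :: real
  assumes "a \<noteq> 0" "0 \<le> b" "0 \<le> p" "0 \<le> t"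
  shows "0 \<le> - (b / a) + exp (a * t) * (p + b / a)"
proof -
  have "0 \<le> b * ((exp (a * t) - 1) / a)"
    using assms by (cases "0 < a") (auto simp: zero_le_divide_iff mult_nonpos_nonneg mult_nonneg_nonpos)
  moreover have "0 \<le> exp (a * t) * p" using assms by simp
  moreover have "- (b / a) + exp (a * t) * (p + b / a) = exp (a * t) * p + b * ((exp (a * t) - 1) / a)"
    using assms(1) by (simp add: field_simps)
  ultimately show ?thesis by linarith
qed

lemma x_flow_nonneg:
  assumes "0 < lam" "m < 2" "0 \<le> t" "0 \<le> p"
  shows "0 \<le> x_flow lam m t p"
  using assms exp_affine_nonneg[of "lam - 1" "lam * (2 - m)" p t] by (auto simp: x_flow_def)

lemma y_flow_nonneg:
  assumes "0 < lam" "1 < m" "0 \<le> t" "0 \<le> p"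
  shows "0 \<le> y_flow lam m t p"
  using assms exp_affine_nonneg[of "lam - 2" "lam * (m - 1)" p t] by (auto simp: y_flow_def)

lemma pdmp_nonneg:
  assumes P: "poisson_process M mu N" and w: "\<omega> \<in> space M" and t: "0 \<le> t" and p: "0 \<le> p"
    and flow: "\<And>t x. 0 \<le> t \<Longrightarrow> 0 \<le> x \<Longrightarrow> 0 \<le> flow t x" and a: "0 \<le> a" and r: "\<And>y. 0 \<le> r y"
  shows "0 \<le> pdmp flow a r N Y p t \<omega>"
proof -
  have "0 \<le> post_jump flow a r (\<lambda>n. jump_time N n \<omega>) (\<lambda>n. Y n \<omega>) p n" for n
    using jump_time_mono[OF P w] by (induction n) (auto intro!: mult_nonneg_nonneg flow p a r)
  moreover have "jump_time N (N t \<omega>) \<omega> \<le> t"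
    using jump_time_le_iff[OF P w t] by simp
  ultimately show ?thesis
    unfolding pdmp_def by (intro flow) auto
qed

context disorder_problem
begin

lemma pdmp_measurable:
  assumes flow [measurable]: "(\<lambda>(t, x). flow t x) \<in> borel_measurable (borel \<Otimes>\<^sub>M borel)"
  shows "(\<lambda>(\<omega>, t). pdmp flow a r N Y p (max 0 t) \<omega>) \<in> borel_measurable (M \<Otimes>\<^sub>M borel)"
proof -
  have flow': "(\<lambda>x. flow (f x) (h x)) \<in> borel_measurable K"
    if [measurable]: "f \<in> borel_measurable K" "h \<in> borel_measurable K" for f h and K :: "'z measure"
    using measurable_compose[OF measurable_Pair[OF that] flow] by simp
  have [measurable]: "(\<lambda>\<omega>. post_jump flow a r (\<lambda>n. jump_time N n \<omega>) (\<lambda>n. Y n \<omega>) p n) \<in> borel_measurable M" for n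
  proof (induction n)
    case (Suc n)
    note Suc [measurable]
    have [measurable]: "Y (Suc n) \<in> borel_measurable M" by (rule Y_measurable) simp
    have [measurable]: "(\<lambda>\<omega>. flow (jump_time N (Suc n) \<omega> - jump_time N n \<omega>)
        (post_jump flow a r (\<lambda>n. jump_time N n \<omega>) (\<lambda>n. Y n \<omega>) p n)) \<in> borel_measurable M"
      by (rule flow') measurable
    show ?case by simp
  qed simp
  have "(\<lambda>x. flow (max 0 (snd x) - jump_time N n (fst x))
      (post_jump flow a r (\<lambda>n. jump_time N n (fst x)) (\<lambda>n. Y n (fst x)) p n)) \<in> borel_measurable (M \<Otimes>\<^sub>M borel)" for n
    by (rule flow') measurable
  moreover have "(\<lambda>x. N (max 0 (snd x)) (fst x)) \<in> measurable (M \<Otimes>\<^sub>M borel) (count_space UNIV)"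
    using measurable_counting_process_joint[OF poisson] by (simp add: case_prod_unfold)
  ultimately show ?thesis
    unfolding pdmp_def case_prod_unfold by (rule measurable_compose_countable)
qed

lemma discounted_cost_measurable:
  assumes [measurable]: "T \<in> borel_measurable M"
  shows "(\<lambda>(\<omega>, t). ereal (indicat_real {t. 0 \<le> t \<and> ennreal t \<le> T \<omega>} t
           * (exp (- lam * t) * g lam c (Phi lam mu m r N Y \<phi> t \<omega>)))) \<in> borel_measurable (M \<Otimes>\<^sub>M lborel)"
proof -
  have [measurable]: "(\<lambda>(t, x). x_flow lam m t x) \<in> borel_measurable (borel \<Otimes>\<^sub>M borel)"
    "(\<lambda>(t, x). y_flow lam m t x) \<in> borel_measurable (borel \<Otimes>\<^sub>M borel)"
    unfolding x_flow_def y_flow_def by measurable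
  note pdmp_measurable [measurable]
  have "(\<lambda>(\<omega>, t). ereal (indicat_real {t. 0 \<le> t \<and> ennreal t \<le> T \<omega>} t
           * (exp (- lam * t) * g lam c (Phi lam mu m r N Y \<phi> t \<omega>))))
      = (\<lambda>(\<omega>, t). ereal ((if 0 \<le> t \<and> ennreal t \<le> T \<omega> then 1 else 0)
           * (exp (- lam * t) * (pdmp (x_flow lam m) (1 + 1 / mu) r N Y (fst \<phi>) (max 0 t) \<omega>
              + pdmp (y_flow lam m) (1 + 2 / mu) r N Y (snd \<phi>) (max 0 t) \<omega> - lam / c))))"
    by (auto simp: g_def Phi_def max_def indicator_def)
  also have "\<dots> \<in> borel_measurable (M \<Otimes>\<^sub>M borel)"
    by measurable
  finally show ?thesis by (simp cong: measurable_cong_sets sets_pair_measure_cong)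
qed

lemma running_cost_measurable:
  assumes "T \<in> borel_measurable M"
  shows "(\<lambda>\<omega>. running_cost lam mu c m r N Y \<phi> (T \<omega>) \<omega>) \<in> borel_measurable M"
  unfolding running_cost_def
  by (rule borel_measurable_ereal_integral[OF lborel.sigma_finite_measure_axioms discounted_cost_measurable[OF assms]])

lemma g_Phi_ge:
  assumes "\<omega> \<in> space M" "0 \<le> t" "\<phi> \<in> {0..} \<times> {0..}"
  shows "- (lam / c) \<le> g lam c (Phi lam mu m r N Y \<phi> t \<omega>)"
proof -
  have "0 \<le> pdmp (x_flow lam m) (1 + 1 / mu) r N Y (fst \<phi>) t \<omega>"
    "0 \<le> pdmp (y_flow lam m) (1 + 2 / mu) r N Y (snd \<phi>) t \<omega>"
    using assms lam mu m r_nonneg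
    by (auto intro!: pdmp_nonneg[OF poisson] x_flow_nonneg y_flow_nonneg)
  then show ?thesis by (simp add: g_def Phi_def)
qed

text \<open>
  The largest rate at which the cost can decrease at time \<open>t\<close> by continuing after time \<open>s\<close>.  The
  factor \<open>1 / c\<close> is split off because the rest is an exponential density restricted to a tail.
\<close>

definition tail_loss :: "real \<Rightarrow> real \<Rightarrow> ennreal" where
  "tail_loss s t = ennreal (1 / c) * (ennreal (lam * exp (- lam * t)) * indicator {s..} t)"

lemma tail_loss_measurable [measurable]: "tail_loss s \<in> borel_measurable borel"
  unfolding tail_loss_def[abs_def] by measurable

lemma enn2ereal_tail_loss:
  "enn2ereal (tail_loss s t) = ereal (if s \<le> t then exp (- lam * t) * (lam / c) else 0)"
  using lam c by (auto simp: tail_loss_def ennreal_mult'[symmetric] enn2ereal_ennreal zero_ennreal.rep_eq)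

lemma nn_integral_tail_loss: "(\<integral>\<^sup>+t. tail_loss s t \<partial>lborel) = ennreal (exp (- lam * s) / c)"
  unfolding tail_loss_def using c
  by (subst nn_integral_cmult) (simp_all add: nn_integral_exp_tail[OF lam, simplified] ennreal_mult'[symmetric])

lemma neg_tail_loss_le:
  assumes "\<omega> \<in> space M" "\<phi> \<in> {0..} \<times> {0..}"
  shows "- enn2ereal (tail_loss 0 t) \<le> ereal (indicat_real {t. 0 \<le> t \<and> ennreal t \<le> T} t
           * (exp (- lam * t) * g lam c (Phi lam mu m r N Y \<phi> t \<omega>)))"
proof -
  have "exp (- lam * t) * - (lam / c) \<le> exp (- lam * t) * g lam c (Phi lam mu m r N Y \<phi> t \<omega>)" if "0 \<le> t"
    using g_Phi_ge[OF assms(1) that assms(2)] by (intro mult_left_mono) auto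
  then show ?thesis
    using lam c by (auto simp: enn2ereal_tail_loss indicator_def)
qed

lemma running_cost_ge:
  assumes "\<omega> \<in> space M" "\<phi> \<in> {0..} \<times> {0..}"
  shows "- ereal (1 / c) \<le> running_cost lam mu c m r N Y \<phi> T \<omega>"
  using ereal_integral_ge[where M = lborel and h = "tail_loss 0", OF neg_tail_loss_le[OF assms]] c
  unfolding running_cost_def by (simp add: nn_integral_tail_loss enn2ereal_ennreal)

text \<open>
  The two integrands differ only at times \<open>t > s\<close>, where the one on the left vanishes and the one on
  the right is at least \<open>- tail_loss s t\<close>.
\<close>

lemma running_cost_min_le:
  assumes w: "\<omega> \<in> space M" and \<phi>: "\<phi> \<in> {0..} \<times> {0..}" and s: "0 \<le> s"
  shows "running_cost lam mu c m r N Y \<phi> (min T (ennreal s)) \<omega>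
    \<le> running_cost lam mu c m r N Y \<phi> T \<omega> + ereal (exp (- lam * s) / c)"
proof -
  define f where "f T t = ereal (indicat_real {t. 0 \<le> t \<and> ennreal t \<le> T} t
           * (exp (- lam * t) * g lam c (Phi lam mu m r N Y \<phi> t \<omega>)))" for T t
  have meas [measurable]: "f T \<in> borel_measurable lborel" for T
    using measurable_compose_Pair1[OF w discounted_cost_measurable[of "\<lambda>_. T" \<phi>]]
    unfolding f_def[abs_def] by simp
  have le: "f (min T (ennreal s)) t \<le> f T t + enn2ereal (tail_loss s t)" for t
  proof -
    have "exp (- lam * t) * - (lam / c) \<le> exp (- lam * t) * g lam c (Phi lam mu m r N Y \<phi> t \<omega>)" if "0 \<le> t"
      using g_Phi_ge[OF w that \<phi>] by (intro mult_left_mono) auto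
    then show ?thesis
      using lam c s by (auto simp: f_def enn2ereal_tail_loss indicator_def not_le)
  qed
  have fin: "(\<integral>\<^sup>+t. e2ennreal (- f T t) \<partial>lborel) < \<infinity>" for T
    using nn_integral_neg_part_le[where M = lborel and h = "tail_loss 0", OF neg_tail_loss_le[OF w \<phi>]]
    unfolding nn_integral_tail_loss f_def by (rule order_le_less_trans) simp
  have "ereal_integral lborel (f (min T (ennreal s)))
      \<le> ereal_integral lborel (f T) + enn2ereal (\<integral>\<^sup>+t. tail_loss s t \<partial>lborel)"
    by (rule ereal_integral_le_add[OF _ _ _ _ fin fin]) (auto intro: le)
  moreover have "running_cost lam mu c m r N Y \<phi> T \<omega> = ereal_integral lborel (f T)" for T
    by (simp only: running_cost_def f_def[abs_def])
  ultimately show ?thesis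
    using c by (simp add: nn_integral_tail_loss enn2ereal_ennreal)
qed

lemma running_cost_zero: "running_cost lam mu c m r N Y \<phi> 0 \<omega> = 0"
  unfolding running_cost_def
  by (rule ereal_integral_zero_AE, use AE_lborel_singleton[of "0::real"] in eventually_elim)
     (auto simp: indicator_def)

section \<open>Comparison of the value functions\<close>

lemma expected_cost_ge:
  assumes "\<phi> \<in> {0..} \<times> {0..}"
  shows "- ereal (1 / c) \<le> ereal_integral M (\<lambda>\<omega>. running_cost lam mu c m r N Y \<phi> (\<tau> \<omega>) \<omega>)"
proof -
  have "- enn2ereal (\<integral>\<^sup>+\<omega>. ennreal (1 / c) \<partial>M)
      \<le> ereal_integral M (\<lambda>\<omega>. running_cost lam mu c m r N Y \<phi> (\<tau> \<omega>) \<omega>)"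
    using running_cost_ge[OF _ assms] c by (intro ereal_integral_ge) (simp add: enn2ereal_ennreal)
  then show ?thesis using c by (simp add: emeasure_space_1 enn2ereal_ennreal)
qed

lemma expected_cost_min_jump_time_le:
  assumes \<tau>: "\<tau> \<in> stopping_times M X0 N Y" and \<phi>: "\<phi> \<in> {0..} \<times> {0..}"
  shows "ereal_integral M (\<lambda>\<omega>. running_cost lam mu c m r N Y \<phi> (min (\<tau> \<omega>) (ennreal (jump_time N n \<omega>))) \<omega>)
    \<le> ereal_integral M (\<lambda>\<omega>. running_cost lam mu c m r N Y \<phi> (\<tau> \<omega>) \<omega>)
      + ereal (1 / c * (mu / (mu + lam)) ^ n)"
proof -
  let ?J = "\<lambda>\<tau> \<omega>. running_cost lam mu c m r N Y \<phi> (\<tau> \<omega>) \<omega>"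
  let ?\<tau>' = "\<lambda>\<omega>. min (\<tau> \<omega>) (ennreal (jump_time N n \<omega>))"
  let ?h = "\<lambda>\<omega>. ennreal (1 / c) * ennreal (exp (- lam * jump_time N n \<omega>))"
  have [measurable]: "\<tau> \<in> borel_measurable M" using \<tau> by (rule stopping_time_measurable)
  have fin: "(\<integral>\<^sup>+\<omega>. e2ennreal (- ?J \<tau> \<omega>) \<partial>M) < \<infinity>" for \<tau>
  proof -
    have "(\<integral>\<^sup>+\<omega>. e2ennreal (- ?J \<tau> \<omega>) \<partial>M) \<le> (\<integral>\<^sup>+\<omega>. ennreal (1 / c) \<partial>M)"
      using running_cost_ge[OF _ \<phi>] c by (intro nn_integral_neg_part_le) (simp add: enn2ereal_ennreal)
    then show ?thesis by (rule order_le_less_trans) (simp add: emeasure_space_1)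
  qed
  have "ereal_integral M (?J ?\<tau>') \<le> ereal_integral M (?J \<tau>) + enn2ereal (\<integral>\<^sup>+\<omega>. ?h \<omega> \<partial>M)"
  proof (rule ereal_integral_le_add[OF _ _ _ _ fin fin])
    show "?J ?\<tau>' \<in> borel_measurable M" "?J \<tau> \<in> borel_measurable M"
      by (intro running_cost_measurable; measurable)+
    show "?J ?\<tau>' \<omega> \<le> ?J \<tau> \<omega> + enn2ereal (?h \<omega>)" if "\<omega> \<in> space M" for \<omega>
      using running_cost_min_le[OF that \<phi> jump_time_nonneg[OF poisson that]] c
      by (simp add: ennreal_mult'[symmetric] enn2ereal_ennreal)
  qed measurable
  also have "(\<integral>\<^sup>+\<omega>. ?h \<omega> \<partial>M) = ennreal (1 / c * (mu / (mu + lam)) ^ n)"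
    using c nn_integral_exp_jump_time[OF prob_space_axioms poisson mu lam, of n]
    by (subst nn_integral_cmult) (auto simp: ennreal_mult'[symmetric])
  finally show ?thesis
    using c mu lam by (simp add: enn2ereal_ennreal)
qed

abbreviation "opt_val \<equiv> V lam mu c m r M X0 N Y"
abbreviation "opt_val_n \<equiv> V_n lam mu c m r M X0 N Y"

lemma opt_val_le_opt_val_n: "opt_val \<phi> \<le> opt_val_n n \<phi>"
  unfolding V_def V_n_def
  by (intro INF_greatest INF_lower2[OF min_jump_time_stopping_time]) auto

lemma opt_val_n_le:
  assumes "\<phi> \<in> {0..} \<times> {0..}"
  shows "opt_val_n n \<phi> \<le> opt_val \<phi> + ereal (1 / c * (mu / (mu + lam)) ^ n)"
proof -
  have "opt_val_n n \<phi> - ereal (1 / c * (mu / (mu + lam)) ^ n) \<le> opt_val \<phi>"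
    unfolding V_def
  proof (rule INF_greatest)
    fix \<tau> assume \<tau>: "\<tau> \<in> stopping_times M X0 N Y"
    then have "opt_val_n n \<phi>
        \<le> ereal_integral M (\<lambda>\<omega>. running_cost lam mu c m r N Y \<phi> (min (\<tau> \<omega>) (ennreal (jump_time N n \<omega>))) \<omega>)"
      unfolding V_n_def by (rule INF_lower)
    also note expected_cost_min_jump_time_le[OF \<tau> assms, of n]
    finally show "opt_val_n n \<phi> - ereal (1 / c * (mu / (mu + lam)) ^ n)
        \<le> ereal_integral M (\<lambda>\<omega>. running_cost lam mu c m r N Y \<phi> (\<tau> \<omega>) \<omega>)"
      by (simp add: ereal_minus_le_iff add.commute)
  qed
  then show ?thesis by (simp add: ereal_minus_le_iff add.commute)
qed

lemma opt_val_ge: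
  assumes "\<phi> \<in> {0..} \<times> {0..}"
  shows "- ereal (1 / c) \<le> opt_val \<phi>"
  unfolding V_def by (intro INF_greatest expected_cost_ge assms)

text \<open>Immediate stopping costs nothing.\<close>

lemma opt_val_n_nonpos: "opt_val_n n \<phi> \<le> 0"
  unfolding V_n_def
proof (rule INF_lower2)
  show "(\<lambda>_. 0) \<in> stopping_times M X0 N Y"
    by (simp add: stopping_times_def stopping_time_const)
  show "ereal_integral M (\<lambda>\<omega>. running_cost lam mu c m r N Y \<phi> (min 0 (ennreal (jump_time N n \<omega>))) \<omega>) \<le> 0"
    by (simp add: min_def running_cost_zero ereal_integral_zero_AE)
qed

end

theorem proposition6p1:
  fixes lam mu c m :: real
    and M :: "'w measure"
    and X0 :: "'w \<Rightarrow> real^'d"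
    and N :: "real \<Rightarrow> 'w \<Rightarrow> nat"
    and Y :: "nat \<Rightarrow> 'w \<Rightarrow> real^'d"
    and \<beta>0 \<beta>1 :: "(real^'d) measure"
    and r :: "real^'d \<Rightarrow> real"
  assumes "lam > 0" and "mu > 0" and "c > 0" and "1 < m" and "m < 2"
    and "prob_space M"
    and "X0 \<in> borel_measurable M"
    and "poisson_process M mu N"
    and "\<And>k. k \<ge> 1 \<Longrightarrow> Y k \<in> borel_measurable M"
    and "\<And>k \<omega> i. k \<ge> 1 \<Longrightarrow> \<omega> \<in> space M \<Longrightarrow> Y k \<omega> $ i > 0"
    and "prob_space.indep_vars M (\<lambda>_. borel) Y {1..}"
    and "\<And>k. k \<ge> 1 \<Longrightarrow> distr M borel (Y k) = \<beta>0"
    and "prob_space.indep_set M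
           (sets (vimage_algebra (space M) (\<lambda>\<omega>. \<lambda>t\<in>{0..}. N t \<omega>)
                   (Pi\<^sub>M {0..} (\<lambda>_. count_space UNIV))))
           (sets (vimage_algebra (space M) (\<lambda>\<omega>. \<lambda>k\<in>{1..}. Y k \<omega>)
                   (Pi\<^sub>M {1..} (\<lambda>_. borel))))"
    and "prob_space \<beta>1" and "sets \<beta>1 = sets borel"
    and "absolutely_continuous \<beta>0 \<beta>1" and "absolutely_continuous \<beta>1 \<beta>0"
    and "r \<in> borel_measurable borel" and "\<And>y. r y \<ge> 0"
    and "AE y in \<beta>0. RN_deriv \<beta>0 \<beta>1 y = ennreal (r y)"
  shows "(\<forall>\<phi>\<in>{0..} \<times> {0..}. \<bar>V lam mu c m r M X0 N Y \<phi>\<bar> \<noteq> \<infinity> \<and>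
            (\<forall>n. \<bar>V_n lam mu c m r M X0 N Y n \<phi>\<bar> \<noteq> \<infinity>)) \<and>
         uniform_limit ({0..} \<times> {0..})
           (\<lambda>n \<phi>. real_of_ereal (V_n lam mu c m r M X0 N Y n \<phi>))
           (\<lambda>\<phi>. real_of_ereal (V lam mu c m r M X0 N Y \<phi>)) sequentially \<and>
         (\<forall>n. \<forall>\<phi>\<in>{0..} \<times> {0..}.
            ereal (1 / c * (mu / (mu + lam)) ^ n)
              \<ge> V_n lam mu c m r M X0 N Y n \<phi> - V lam mu c m r M X0 N Y \<phi> \<and>
            V_n lam mu c m r M X0 N Y n \<phi> - V lam mu c m r M X0 N Y \<phi> \<ge> 0)"
proof -
  interpret disorder_problem M lam mu c m X0 N Y r
    using assms by (simp add: disorder_problem_def disorder_problem_axioms_def)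
  \<comment> \<open>All values are finite, so the bound passes to real numbers, where it gives uniform convergence.\<close>
  define q where "q n = 1 / c * (mu / (mu + lam)) ^ n" for n
  define v where "v \<phi> = real_of_ereal (opt_val \<phi>)" for \<phi>
  define w where "w n \<phi> = real_of_ereal (opt_val_n n \<phi>)" for n \<phi>
  have fin: "\<bar>opt_val \<phi>\<bar> \<noteq> \<infinity>" "\<bar>opt_val_n n \<phi>\<bar> \<noteq> \<infinity>" if "\<phi> \<in> {0..} \<times> {0..}" for n \<phi>
    using opt_val_ge[OF that] opt_val_le_opt_val_n[of \<phi> n] opt_val_n_nonpos[of n \<phi>]
    by (cases "opt_val \<phi>"; cases "opt_val_n n \<phi>"; auto)+
  have v: "opt_val \<phi> = ereal (v \<phi>)" and w: "opt_val_n n \<phi> = ereal (w n \<phi>)" if "\<phi> \<in> {0..} \<times> {0..}" for n \<phi>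
    using fin[OF that] by (auto simp: v_def w_def ereal_real)
  have bound: "0 \<le> w n \<phi> - v \<phi>" "w n \<phi> - v \<phi> \<le> q n" if "\<phi> \<in> {0..} \<times> {0..}" for n \<phi>
    using opt_val_le_opt_val_n[of \<phi> n] opt_val_n_le[OF that, of n] v[OF that] w[OF that]
    by (auto simp: q_def)
  have "q \<longlonglongrightarrow> 1 / c * 0"
    unfolding q_def using \<open>0 < lam\<close> \<open>0 < mu\<close> by (intro tendsto_intros LIMSEQ_realpow_zero) auto
  then have q: "q \<longlonglongrightarrow> 0" by simp
  have "uniform_limit ({0..} \<times> {0..}) w v sequentially"
    unfolding uniform_limit_iff
  proof (intro allI impI)
    fix e :: real assume "0 < e"
    with q have "eventually (\<lambda>n. q n < e) sequentially" by (rule order_tendstoD)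
    then show "\<forall>\<^sub>F n in sequentially. \<forall>\<phi>\<in>{0..} \<times> {0..}. dist (w n \<phi>) (v \<phi>) < e"
    proof (rule eventually_mono, intro ballI)
      fix n and \<phi> :: "real \<times> real" assume "q n < e" "\<phi> \<in> {0..} \<times> {0..}"
      with bound[of \<phi> n] show "dist (w n \<phi>) (v \<phi>) < e" by (simp add: dist_real_def)
    qed
  qed
  moreover have "ereal (q n) \<ge> opt_val_n n \<phi> - opt_val \<phi> \<and> opt_val_n n \<phi> - opt_val \<phi> \<ge> 0"
    if "\<phi> \<in> {0..} \<times> {0..}" for n \<phi>
    using bound[OF that, of n] by (simp add: v[OF that] w[OF that])
  ultimately show ?thesis
    using fin unfolding v_def[abs_def] w_def[abs_def] q_def by (intro conjI ballI allI) simp_all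
qed

end
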